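(* Let $p>1$ and let $G$ be a finite simple connected graph with exactly $n\geq 4$ edges and with nonempty boundary $B(G)$. Then $$\lambda_{1,p}(G)\geq \lambda_{1,p}(T_{n,3}),$$ and equality holds if and only if $G$ is isomorphic to $T_{n,3}$.
   Context: For a finite simple connected graph $G$, its boundary is $B(G)=\{x\in V(G): \deg(x)=1\}$ (the pendant vertices) and its interior is $\Omega(G)=V(G)\setminus B(G)$. For $p\ge 1$, let $C_B(G)=\{f\in\mathbb{R}^{V(G)}: f|_{B(G)}\equiv 0\}$ and define the first $p$-Dirichlet eigenvalue $$\lambda_{1,p}(G)=\min_{f\in C_B(G)\setminus\{0\}}\frac{\sum_{\{x,y\}\in E(G)}|f(x)-f(y)|^p}{\sum_{x\in V(G)}|f(x)|^p}.$$ For $n>i\ge 3$, the tadpole graph $T_{n,i}$ is the graph on vertices $t_1,\dots,t_n$ with edges $t_n\sim t_{n-1}\sim\cdots\sim t_i\sim t_{i-1}\sim\cdots\sim t_2\sim t_1\sim t_i$, i.e. a cycle of length $i$ with a path attached at $t_i$; it has $n$ vertices and $n$ edges and its only boundary vertex is $t_n$. *)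

theory Defs
  imports Complex_Main
begin

text \<open>A finite simple graph is given by a vertex set V and a set E of
  2-element subsets of V (the edges).\<close>

definition simple_graph :: "'a set \<Rightarrow> 'a set set \<Rightarrow> bool" where
  "simple_graph V E \<longleftrightarrow> finite V \<and>
     (\<forall>e\<in>E. \<exists>x y. e = {x, y} \<and> x \<in> V \<and> y \<in> V \<and> x \<noteq> y)"

definition adj :: "'a set set \<Rightarrow> 'a \<Rightarrow> 'a \<Rightarrow> bool" where
  "adj E x y \<longleftrightarrow> {x, y} \<in> E \<and> x \<noteq> y"

definition connected_graph :: "'a set \<Rightarrow> 'a set set \<Rightarrow> bool" where
  "connected_graph V E \<longleftrightarrow> V \<noteq> {} \<and>
     (\<forall>x\<in>V. \<forall>y\<in>V. (x, y) \<in> {(u, v). adj E u v}\<^sup>*)"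

definition degree :: "'a set \<Rightarrow> 'a set set \<Rightarrow> 'a \<Rightarrow> nat" where
  "degree V E x = card {y \<in> V. adj E x y}"

text \<open>Boundary: the pendant vertices (degree 1).\<close>
definition boundary :: "'a set \<Rightarrow> 'a set set \<Rightarrow> 'a set" where
  "boundary V E = {x \<in> V. degree V E x = 1}"

text \<open>p-Dirichlet energy: sum over edges {x,y} of |f x - f y|^p. Each edge
  corresponds to exactly two ordered pairs, hence the division by 2.\<close>
definition p_energy :: "real \<Rightarrow> 'a set \<Rightarrow> 'a set set \<Rightarrow> ('a \<Rightarrow> real) \<Rightarrow> real" where
  "p_energy p V E f =
     (\<Sum>(x, y)\<in>{(x, y) \<in> V \<times> V. adj E x y}. \<bar>f x - f y\<bar> powr p) / 2"

definition p_norm_pow :: "real \<Rightarrow> 'a set \<Rightarrow> ('a \<Rightarrow> real) \<Rightarrow> real" where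
  "p_norm_pow p V f = (\<Sum>x\<in>V. \<bar>f x\<bar> powr p)"

text \<open>First p-Dirichlet eigenvalue: the minimum (here written as infimum,
  which is attained) of the Rayleigh quotient over nonzero functions on V
  vanishing on the boundary.\<close>
definition lambda1p :: "real \<Rightarrow> 'a set \<Rightarrow> 'a set set \<Rightarrow> real" where
  "lambda1p p V E = Inf {p_energy p V E f / p_norm_pow p V f | f.
       (\<forall>x\<in>boundary V E. f x = 0) \<and> (\<exists>x\<in>V. f x \<noteq> 0)}"

text \<open>Tadpole graph T_{n,i} on vertices 1..n: path edges {k,k+1}, k=1..n-1,
  plus the edge {1,i}.\<close>
definition tadpole_V :: "nat \<Rightarrow> nat set" where
  "tadpole_V n = {1..n}"

definition tadpole_E :: "nat \<Rightarrow> nat \<Rightarrow> nat set set" where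
  "tadpole_E n i = insert {1, i} {{k, k + 1} | k. 1 \<le> k \<and> k < n}"

definition graph_iso :: "'a set \<Rightarrow> 'a set set \<Rightarrow> 'b set \<Rightarrow> 'b set set \<Rightarrow> bool" where
  "graph_iso V E W F \<longleftrightarrow> (\<exists>h. bij_betw h V W \<and>
     (\<forall>x\<in>V. \<forall>y\<in>V. {x, y} \<in> E \<longleftrightarrow> {h x, h y} \<in> F))"

end

theory Submission
  imports Defs
begin

text \<open>Given f \<ge> 0 on G vanishing on the boundary, rank the interior vertices by decreasing f and put
  the i-th largest value on vertex i of the tadpole; by the handshake lemma there are at most n - 1
  interior vertices, so the rearrangement fits and vanishes at n. The energy does not increase.
  Superadditivity of t powr p on t \<ge> 0 splits each edge of G into its part among the three top ranks
  and the single gaps below. Every gap is cut by some edge by connectivity, and since the two top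
  vertices have degree at least 2, the top parts dominate the energy of the triangle.

  If the eigenvalues agree, then the rearrangement of a minimiser on G is a minimiser on the tadpole,
  hence strictly decreasing from vertex 2 on. Strict superadditivity then forbids edges of G that skip
  a rank below 3, only one edge reaches the boundary, and counting edges makes the ranking an
  isomorphism.\<close>

section \<open>Inequalities for real powers\<close>

text \<open>Writing \<open>x powr p\<close> as \<open>x * x powr (p - 1)\<close> on
  \<open>0 \<le> x\<close>, both factors \<open>a powr (p - 1)\<close> and
  \<open>b powr (p - 1)\<close> can be raised to \<open>(a + b) powr (p - 1)\<close>.\<close>

lemma powr_add_superadditive:
  fixes a b p :: real
  assumes "0 \<le> a" "0 \<le> b" "1 \<le> p"
  shows "a powr p + b powr p \<le> (a + b) powr p"
proof -
  have pw: "x powr p = x * x powr (p - 1)" if "0 \<le> x" for x :: real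
    using that powr_mult_base[of x "p - 1"] by simp
  have "a powr p + b powr p = a * a powr (p - 1) + b * b powr (p - 1)"
    using assms pw by simp
  also have "\<dots> \<le> a * (a + b) powr (p - 1) + b * (a + b) powr (p - 1)"
    using assms by (intro add_mono mult_left_mono powr_mono2) auto
  also have "\<dots> = (a + b) powr p"
    using assms pw[of "a + b"] by (simp add: algebra_simps)
  finally show ?thesis .
qed

lemma powr_add_strict_superadditive:
  fixes a b p :: real
  assumes "0 < a" "0 < b" "1 < p"
  shows "a powr p + b powr p < (a + b) powr p"
proof -
  have pw: "x powr p = x * x powr (p - 1)" if "0 \<le> x" for x :: real
    using that powr_mult_base[of x "p - 1"] by simp
  have "a powr p + b powr p = a * a powr (p - 1) + b * b powr (p - 1)"
    using assms pw by simp
  also have "\<dots> < a * (a + b) powr (p - 1) + b * (a + b) powr (p - 1)"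
    using assms by (intro add_strict_mono mult_strict_left_mono powr_less_mono2) auto
  also have "\<dots> = (a + b) powr p"
    using assms pw[of "a + b"] by (simp add: algebra_simps)
  finally show ?thesis .
qed

text \<open>A weakened tangent bound: for a > 0 the slope \<open>a powr (p - 1)\<close> is positive,
  which gives the gain in norm that is linear in t when a minimiser is perturbed.\<close>

lemma powr_add_ge_linear:
  fixes a t p :: real
  assumes "0 \<le> a" "0 \<le> t" "1 \<le> p"
  shows "a powr p + t * a powr (p - 1) \<le> (a + t) powr p"
proof -
  have pw: "x powr p = x * x powr (p - 1)" if "0 \<le> x" for x :: real
    using that powr_mult_base[of x "p - 1"] by simp
  have "a powr p + t * a powr (p - 1) = (a + t) * a powr (p - 1)"
    using assms pw[of a] by (simp add: algebra_simps)
  also have "\<dots> \<le> (a + t) * (a + t) powr (p - 1)"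
    using assms by (intro mult_left_mono powr_mono2) auto
  also have "\<dots> = (a + t) powr p"
    using assms pw[of "a + t"] by simp
  finally show ?thesis .
qed

text \<open>Because p exceeds 1, \<open>t powr p\<close> is of smaller order than t near 0. This
  closes the perturbation arguments, where a linear gain would be paid for at order
  \<open>t powr p\<close>.\<close>

lemma linear_not_bounded_by_powr:
  fixes c K e p :: real
  assumes "0 < c" "0 < K" "0 < e" "1 < p"
    and bound: "\<And>t. 0 < t \<Longrightarrow> t \<le> e \<Longrightarrow> c * t \<le> K * t powr p"
  shows False
proof -
  \<comment> \<open>With these values \<open>K * t powr (p - 1)\<close> is at most c / 2, whereas
    the assumed bound divided by t makes it at least c.\<close>
  define d where "d = c / (2 * K)"
  define t where "t = min e (d powr (1 / (p - 1)))"
  have "0 < d" using assms by (simp add: d_def)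
  have t: "0 < t" "t \<le> e" using assms \<open>0 < d\<close> by (auto simp: t_def)
  have "t powr (p - 1) \<le> (d powr (1 / (p - 1))) powr (p - 1)"
    using t assms by (intro powr_mono2) (auto simp: t_def)
  also have "\<dots> = d" using assms \<open>0 < d\<close> by (simp add: powr_powr)
  finally have "K * t powr (p - 1) \<le> c / 2"
    using assms by (simp add: d_def field_simps)
  moreover have "c * t \<le> K * t powr (p - 1) * t"
    using bound[OF t] powr_mult_base[of t "p - 1"] t by (simp add: ac_simps)
  then have "c \<le> K * t powr (p - 1)" using t by simp
  ultimately show False using assms by simp
qed

text \<open>Iterated superadditivity. The conjunct \<open>g l \<le> g i\<close> travels through the
  induction because each step adds to a difference that has to be nonnegative.\<close>

lemma sum_powr_gaps_le:
  fixes g :: "nat \<Rightarrow> real"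
  assumes "1 \<le> p" "i \<le> l"
    and anti: "\<And>j. i \<le> j \<Longrightarrow> j < l \<Longrightarrow> g (Suc j) \<le> g j"
  shows "g l \<le> g i \<and> (\<Sum>j=i..<l. (g j - g (Suc j)) powr p) \<le> (g i - g l) powr p"
  using \<open>i \<le> l\<close> anti
proof (induction l rule: dec_induct)
  case base
  then show ?case by simp
next
  case (step m)
  have IH: "g m \<le> g i" "(\<Sum>j=i..<m. (g j - g (Suc j)) powr p) \<le> (g i - g m) powr p"
    using step.IH step.prems by auto
  have m: "g (Suc m) \<le> g m" using step by simp
  have "(g i - g m) powr p + (g m - g (Suc m)) powr p \<le> (g i - g (Suc m)) powr p"
    using powr_add_superadditive[of "g i - g m" "g m - g (Suc m)" p] IH m assms(1) by simp
  then show ?case using IH m step.hyps by simp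
qed

section \<open>Rankings and compactness on finite sets\<close>

text \<open>A vertex is ranked by its position in a list sorted by \<open>- f x\<close>. Positions
  are distinct even where f repeats a value, so ties do not spoil bijectivity.\<close>

lemma finite_ranking:
  fixes f :: "'a \<Rightarrow> real"
  assumes "finite I"
  obtains h where "bij_betw h I {1..card I}"
    and "\<And>x y. x \<in> I \<Longrightarrow> y \<in> I \<Longrightarrow> h x \<le> h y \<Longrightarrow> f y \<le> f x"
proof -
  obtain xs where xs: "set xs = I" "distinct xs"
    using finite_distinct_list[OF assms] by blast
  define ys where "ys = sort_key (\<lambda>x. - f x) xs"
  have ys: "set ys = I" "distinct ys" "sorted (map (\<lambda>x. - f x) ys)"
    using xs by (auto simp: ys_def)
  have len: "length ys = card I" using distinct_card[OF ys(2)] ys(1) by simp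
  have b: "bij_betw (\<lambda>j. ys ! j) {..<card I} I"
    using bij_betw_nth[OF ys(2) refl refl] unfolding ys(1) len .
  define r where "r = the_inv_into {..<card I} (\<lambda>j. ys ! j)"
  have r: "bij_betw r I {..<card I}"
    using bij_betw_the_inv_into[OF b] by (simp add: r_def)
  have rn: "ys ! (r x) = x" "r x < card I" if "x \<in> I" for x
    using b r that f_the_inv_into_f_bij_betw[OF b, of x] bij_betwE[OF r]
    by (auto simp: r_def)
  \<comment> \<open>List positions start at 0 and ranks at 1, hence the shift by
    \<open>Suc\<close>.\<close>
  have "bij_betw (Suc \<circ> r) I {1..card I}"
  proof (rule bij_betw_trans[OF r])
    show "bij_betw Suc {..<card I} {1..card I}"
      by (rule bij_betw_byWitness[where f' = "\<lambda>n. n - 1"]) auto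
  qed
  moreover have "f y \<le> f x" if "x \<in> I" "y \<in> I" "(Suc \<circ> r) x \<le> (Suc \<circ> r) y" for x y
    using sorted_nth_mono[OF ys(3), of "r x" "r y"] rn[OF that(1)] rn[OF that(2)] that(3) len
    by simp
  ultimately show ?thesis using that by blast
qed

text \<open>Bolzano-Weierstrass, one point of V at a time: thinning the sequence for a new point
  keeps the limits already obtained.\<close>

lemma finite_pointwise_convergent_subsequence:
  fixes u :: "nat \<Rightarrow> 'a \<Rightarrow> real"
  assumes "finite V" "\<And>m x. x \<in> V \<Longrightarrow> \<bar>u m x\<bar> \<le> C"
  obtains r l where "strict_mono r" "\<And>x. x \<in> V \<Longrightarrow> (\<lambda>m. u (r m) x) \<longlonglongrightarrow> l x"
proof -
  have "\<exists>r l. strict_mono r \<and> (\<forall>x\<in>V. (\<lambda>m. u (r m) x) \<longlonglongrightarrow> l x)"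
    using assms
  proof (induction V rule: finite_induct)
    case empty
    show ?case using strict_mono_id by (auto simp: id_def)
  next
    case (insert a W)
    then obtain r l where r: "strict_mono r" "\<forall>x\<in>W. (\<lambda>m. u (r m) x) \<longlonglongrightarrow> l x"
      by (metis insertI2)
    \<comment> \<open>Every real sequence has a monotone subsequence, and the bound C makes it
      converge.\<close>
    obtain s where s: "strict_mono s" "monoseq (\<lambda>m. u (r (s m)) a)"
      using seq_monosub[of "\<lambda>m. u (r m) a"] by blast
    have "Bseq (\<lambda>m. u (r (s m)) a)"
      using insert.prems by (intro BseqI'[where K = C]) auto
    then obtain c where c: "(\<lambda>m. u (r (s m)) a) \<longlonglongrightarrow> c"
      using Bseq_monoseq_convergent s(2) by (auto simp: convergent_def)
    have "strict_mono (r \<circ> s)" using r s by (simp add: strict_mono_o)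
    moreover have "(\<lambda>m. u ((r \<circ> s) m) x) \<longlonglongrightarrow> (l(a := c)) x" if "x \<in> insert a W" for x
    proof (cases "x = a")
      case True
      then show ?thesis using c by simp
    next
      case False
      then have "(\<lambda>m. u (r m) x) \<longlonglongrightarrow> l x" using r that by simp
      from LIMSEQ_subseq_LIMSEQ[OF this s(1)] show ?thesis using False by (simp add: o_def)
    qed
    ultimately show ?case by blast
  qed
  then show ?thesis using that by blast
qed

subsection \<open>Rayleigh quotients\<close>

lemma p_energy_nonneg: "0 \<le> p_energy p V E f"
  unfolding p_energy_def by (intro divide_nonneg_nonneg sum_nonneg) auto

lemma p_norm_pow_nonneg: "0 \<le> p_norm_pow p V f"
  unfolding p_norm_pow_def by (intro sum_nonneg) auto

lemma p_norm_pow_pos: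
  assumes "finite V" "\<exists>x\<in>V. f x \<noteq> 0"
  shows "0 < p_norm_pow p V f"
proof -
  obtain x where "x \<in> V" "f x \<noteq> 0" using assms by blast
  then show ?thesis unfolding p_norm_pow_def using assms(1)
    by (intro sum_pos2[of V x]) auto
qed

lemma p_energy_cong: "(\<And>x. x \<in> V \<Longrightarrow> f x = f' x) \<Longrightarrow> p_energy p V E f = p_energy p V E f'"
  unfolding p_energy_def by (auto intro!: sum.cong)

lemma p_norm_pow_cong: "(\<And>x. x \<in> V \<Longrightarrow> f x = f' x) \<Longrightarrow> p_norm_pow p V f = p_norm_pow p V f'"
  unfolding p_norm_pow_def by (auto intro!: sum.cong)

text \<open>Reverse triangle inequality on each edge. The norm term is unchanged, so test functions
  may be taken nonnegative.\<close>

lemma p_energy_abs_le: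
  assumes "0 \<le> p"
  shows "p_energy p V E (\<lambda>x. \<bar>f x\<bar>) \<le> p_energy p V E f"
  unfolding p_energy_def using assms
  by (intro divide_right_mono sum_mono) (auto intro!: powr_mono2)

lemma p_energy_scale: "p_energy p V E (\<lambda>x. c * f x) = \<bar>c\<bar> powr p * p_energy p V E f"
proof -
  have "\<bar>c * f x - c * f y\<bar> powr p = \<bar>c\<bar> powr p * \<bar>f x - f y\<bar> powr p" for x y
    by (simp add: right_diff_distrib[symmetric] abs_mult powr_mult)
  then show ?thesis unfolding p_energy_def by (simp add: sum_distrib_left case_prod_unfold)
qed

lemma p_norm_pow_scale: "p_norm_pow p V (\<lambda>x. c * f x) = \<bar>c\<bar> powr p * p_norm_pow p V f"
  unfolding p_norm_pow_def by (simp add: sum_distrib_left abs_mult powr_mult)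

lemma lambda1p_le:
  assumes "\<forall>x\<in>boundary V E. f x = 0" "\<exists>x\<in>V. f x \<noteq> 0"
  shows "lambda1p p V E \<le> p_energy p V E f / p_norm_pow p V f"
  unfolding lambda1p_def using assms
  by (intro cInf_lower bdd_belowI[of _ 0])
     (auto intro!: divide_nonneg_nonneg p_energy_nonneg p_norm_pow_nonneg)

text \<open>The product form of the Rayleigh bound, which also covers functions vanishing on all of
  V.\<close>

lemma lambda1p_mult_le:
  assumes "finite V" "\<forall>x\<in>boundary V E. f x = 0"
  shows "lambda1p p V E * p_norm_pow p V f \<le> p_energy p V E f"
proof (cases "\<exists>x\<in>V. f x \<noteq> 0")
  case True
  then show ?thesis
    using lambda1p_le[OF assms(2) True, of p] p_norm_pow_pos[OF assms(1) True, of p]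
    by (simp add: field_simps)
next
  case False
  then have "p_norm_pow p V f = 0" by (simp add: p_norm_pow_def)
  then show ?thesis by (simp add: p_energy_nonneg)
qed

text \<open>An interior vertex makes the set of quotients nonempty, its indicator being admissible;
  only then is \<open>Inf\<close> a greatest lower bound.\<close>

lemma lambda1p_ge:
  assumes "V - boundary V E \<noteq> {}"
    and "\<And>f. \<forall>x\<in>boundary V E. f x = 0 \<Longrightarrow> \<exists>x\<in>V. f x \<noteq> 0 \<Longrightarrow>
           c \<le> p_energy p V E f / p_norm_pow p V f"
  shows "c \<le> lambda1p p V E"
proof -
  obtain v where "v \<in> V" "v \<notin> boundary V E" using assms(1) by blast
  then have "p_energy p V E (\<lambda>x. of_bool (x = v)) / p_norm_pow p V (\<lambda>x. of_bool (x = v))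
      \<in> {p_energy p V E f / p_norm_pow p V f | f.
           (\<forall>x\<in>boundary V E. f x = 0) \<and> (\<exists>x\<in>V. f x \<noteq> 0)}"
    by (intro CollectI exI[of _ "\<lambda>x. of_bool (x = v)"]) auto
  then show ?thesis unfolding lambda1p_def using assms(2) by (intro cInf_greatest) auto
qed

text \<open>Direct method: a minimising sequence of unit norm is bounded at every vertex, a
  subsequence converges pointwise, and energy and norm are continuous in the values. Taking absolute
  values of the limit makes it nonnegative.\<close>

lemma lambda1p_attained:
  assumes "finite V" "V - boundary V E \<noteq> {}" "0 < p"
  obtains f where "\<forall>x\<in>boundary V E. f x = 0" "\<exists>x\<in>V. f x \<noteq> 0" "\<And>x. 0 \<le> f x"
    and "p_energy p V E f = lambda1p p V E * p_norm_pow p V f"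
proof -
  let ?adm = "\<lambda>f. (\<forall>x\<in>boundary V E. f x = (0::real)) \<and> (\<exists>x\<in>V. f x \<noteq> 0)"
  have ex: "\<exists>f. ?adm f \<and> p_norm_pow p V f = 1 \<and> p_energy p V E f < lambda1p p V E + 1 / Suc m" for m
  proof -
    have "\<exists>f. ?adm f \<and> p_energy p V E f / p_norm_pow p V f < lambda1p p V E + 1 / Suc m"
    proof (rule ccontr)
      assume "\<not> ?thesis"
      then have "lambda1p p V E + 1 / Suc m \<le> lambda1p p V E"
        by (intro lambda1p_ge assms(2)) (auto simp: not_less)
      then show False by simp
    qed
    then obtain f where f: "?adm f"
      "p_energy p V E f / p_norm_pow p V f < lambda1p p V E + 1 / Suc m" by blast
    have N: "0 < p_norm_pow p V f" using p_norm_pow_pos assms(1) f(1) by blast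
    \<comment> \<open>The exponent makes \<open>\<bar>c\<bar> powr p\<close> the reciprocal of the
      norm term, so scaling by c gives norm 1 and turns the energy into the quotient.\<close>
    define c where "c = p_norm_pow p V f powr (- 1 / p)"
    have c: "0 < c" "\<bar>c\<bar> powr p = 1 / p_norm_pow p V f"
      using N assms(3) by (simp_all add: c_def powr_powr powr_minus_divide[of _ 1])
    have "?adm (\<lambda>x. c * f x)" using f c by simp
    moreover have "p_norm_pow p V (\<lambda>x. c * f x) = 1"
      unfolding p_norm_pow_scale c(2) using N by simp
    moreover have "p_energy p V E (\<lambda>x. c * f x) < lambda1p p V E + 1 / Suc m"
      unfolding p_energy_scale c(2) using f(2) by simp
    ultimately show ?thesis by (intro exI[of _ "\<lambda>x. c * f x"]) iprover
  qed
  from choice[OF allI[OF ex]] obtain u where "\<forall>m. ?adm (u m) \<and> p_norm_pow p V (u m) = 1 \<and>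
    p_energy p V E (u m) < lambda1p p V E + 1 / Suc m" ..
  then have u: "\<And>m. ?adm (u m)" "\<And>m. p_norm_pow p V (u m) = 1"
    "\<And>m. p_energy p V E (u m) < lambda1p p V E + 1 / Suc m" by blast+
  have bd: "\<bar>u m x\<bar> \<le> 1" if "x \<in> V" for m x
  proof -
    have "\<bar>u m x\<bar> powr p \<le> 1"
      using u(2)[of m] member_le_sum[of x V "\<lambda>x. \<bar>u m x\<bar> powr p"] that assms(1)
      by (simp add: p_norm_pow_def)
    moreover have "1 < \<bar>u m x\<bar> powr p" if "1 < \<bar>u m x\<bar>"
      using powr_less_mono2[OF assms(3) _ that] by simp
    ultimately show ?thesis by linarith
  qed
  obtain r l where r: "strict_mono r" and l: "\<And>x. x \<in> V \<Longrightarrow> (\<lambda>m. u (r m) x) \<longlonglongrightarrow> l x"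
    using finite_pointwise_convergent_subsequence[of V u 1] assms(1) bd by metis
  have "(\<lambda>m. p_norm_pow p V (u (r m))) \<longlonglongrightarrow> p_norm_pow p V l"
    unfolding p_norm_pow_def using assms l
    by (intro tendsto_sum tendsto_powr' tendsto_rabs tendsto_const) auto
  then have N: "p_norm_pow p V l = 1"
    using u(2) LIMSEQ_unique[OF _ tendsto_const] by simp
  have En: "(\<lambda>m. p_energy p V E (u (r m))) \<longlonglongrightarrow> p_energy p V E l"
    unfolding p_energy_def case_prod_unfold using assms l
    by (intro tendsto_divide tendsto_sum tendsto_powr' tendsto_rabs tendsto_diff tendsto_const) auto
  have "(\<lambda>m. lambda1p p V E + 1 / Suc m) \<longlonglongrightarrow> lambda1p p V E + 0"
    by (intro tendsto_intros LIMSEQ_Suc lim_1_over_n)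
  from LIMSEQ_subseq_LIMSEQ[OF this r]
  have "(\<lambda>m. lambda1p p V E + 1 / Suc (r m)) \<longlonglongrightarrow> lambda1p p V E" by (simp add: o_def)
  then have le: "p_energy p V E l \<le> lambda1p p V E"
    using LIMSEQ_le[OF En] u(3) less_imp_le by blast
  have l0: "l x = 0" if "x \<in> boundary V E" for x
  proof -
    have "(\<lambda>m. u (r m) x) \<longlonglongrightarrow> l x" using l that by (simp add: boundary_def)
    moreover have "(\<lambda>m. u (r m) x) = (\<lambda>m. 0)" using u(1) that by auto
    ultimately show ?thesis using LIMSEQ_unique tendsto_const by metis
  qed
  have nz: "\<exists>x\<in>V. l x \<noteq> 0"
  proof (rule ccontr)
    assume "\<not> ?thesis"
    then have "p_norm_pow p V l = 0" by (simp add: p_norm_pow_def)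
    then show False using N by simp
  qed
  have N': "p_norm_pow p V (\<lambda>x. \<bar>l x\<bar>) = 1" using N by (simp add: p_norm_pow_def)
  have "p_energy p V E (\<lambda>x. \<bar>l x\<bar>) \<le> lambda1p p V E"
    using le p_energy_abs_le[of p V E l] assms(3) by simp
  moreover have "lambda1p p V E \<le> p_energy p V E (\<lambda>x. \<bar>l x\<bar>)"
    using lambda1p_mult_le[OF assms(1), of E "\<lambda>x. \<bar>l x\<bar>" p] l0 N' by simp
  ultimately have "p_energy p V E (\<lambda>x. \<bar>l x\<bar>) = lambda1p p V E * p_norm_pow p V (\<lambda>x. \<bar>l x\<bar>)"
    using N' by simp
  then show ?thesis using that[of "\<lambda>x. \<bar>l x\<bar>"] l0 nz by auto
qed

text \<open>Test functions on W pull back along the isomorphism to test functions on V with the same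
  quotient.\<close>

lemma graph_iso_lambda1p_le:
  assumes "graph_iso V E W F" "W - boundary W F \<noteq> {}"
  shows "lambda1p p V E \<le> lambda1p p W F"
proof -
  obtain h where b: "bij_betw h V W"
    and hE: "\<And>x y. x \<in> V \<Longrightarrow> y \<in> V \<Longrightarrow> {x, y} \<in> E \<longleftrightarrow> {h x, h y} \<in> F"
    using assms unfolding graph_iso_def by blast
  have inj: "inj_on h V" and im: "h ` V = W" using b by (auto simp: bij_betw_def)
  have adj: "adj F (h x) (h y) \<longleftrightarrow> adj E x y" if "x \<in> V" "y \<in> V" for x y
    using that hE inj by (auto simp: adj_def inj_on_eq_iff)
  have deg: "degree W F (h x) = degree V E x" if "x \<in> V" for x
  proof -
    have "{y \<in> W. adj F (h x) y} = h ` {y \<in> V. adj E x y}"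
      using im adj that by auto
    then show ?thesis unfolding degree_def
      using card_image[of h "{y \<in> V. adj E x y}"] inj by (auto simp: inj_on_def)
  qed
  have bd: "h x \<in> boundary W F" if "x \<in> boundary V E" for x
    using that deg im by (auto simp: boundary_def)
  show ?thesis
  proof (rule lambda1p_ge[OF assms(2)])
    fix f :: "'b \<Rightarrow> real"
    assume f: "\<forall>x\<in>boundary W F. f x = 0" "\<exists>x\<in>W. f x \<noteq> 0"
    have "p_norm_pow p W f = p_norm_pow p V (f \<circ> h)"
      unfolding p_norm_pow_def im[symmetric] by (simp add: sum.reindex[OF inj])
    moreover have "p_energy p W F f = p_energy p V E (f \<circ> h)"
    proof -
      have "{(x, y) \<in> W \<times> W. adj F x y} = map_prod h h ` {(x, y) \<in> V \<times> V. adj E x y}"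
        using im adj by force
      moreover have "inj_on (map_prod h h) {(x, y) \<in> V \<times> V. adj E x y}"
        using inj by (auto simp: inj_on_def)
      ultimately show ?thesis unfolding p_energy_def
        by (simp add: sum.reindex case_prod_unfold)
    qed
    moreover have "\<forall>x\<in>boundary V E. (f \<circ> h) x = 0" using f(1) bd by simp
    moreover have "\<exists>x\<in>V. (f \<circ> h) x \<noteq> 0" using f(2) im by auto
    ultimately show "lambda1p p V E \<le> p_energy p W F f / p_norm_pow p W f"
      using lambda1p_le[of V E "f \<circ> h" p] by simp
  qed
qed

text \<open>A labelling that separates adjacent vertices selects one of the two ordered pairs of
  each edge, which cancels the division by 2.\<close>

lemma p_energy_oriented:
  fixes r :: "'a \<Rightarrow> nat"
  assumes "finite V" and ne: "\<And>x y. x \<in> V \<Longrightarrow> y \<in> V \<Longrightarrow> adj E x y \<Longrightarrow> r x \<noteq> r y"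
  shows "p_energy p V E f
    = (\<Sum>(x, y)\<in>{(x, y) \<in> V \<times> V. adj E x y \<and> r x < r y}. \<bar>f x - f y\<bar> powr p)"
proof -
  let ?A = "{(x, y) \<in> V \<times> V. adj E x y \<and> r x < r y}"
  let ?w = "\<lambda>(x, y). \<bar>f x - f y\<bar> powr p"
  have fin: "finite ?A" using assms(1) by (auto intro: finite_subset[of _ "V \<times> V"])
  have sym: "adj E x y \<longleftrightarrow> adj E y x" for x y
    by (auto simp: adj_def insert_commute)
  have "{(x, y) \<in> V \<times> V. adj E x y} = ?A \<union> prod.swap ` ?A"
    using ne sym by (auto simp: image_iff) (metis linorder_neqE_nat)
  moreover have "?A \<inter> prod.swap ` ?A = {}" by auto
  ultimately have "sum ?w {(x, y) \<in> V \<times> V. adj E x y} = sum ?w ?A + sum ?w (prod.swap ` ?A)"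
    using fin by (simp add: sum.union_disjoint)
  also have "sum ?w (prod.swap ` ?A) = sum ?w ?A"
    by (subst sum.reindex) (auto simp: case_prod_unfold abs_minus_commute intro!: sum.cong inj_onI)
  finally show ?thesis by (simp add: p_energy_def)
qed

subsection \<open>Graphs with a pendant vertex\<close>

lemma adj_sym: "adj E x y \<Longrightarrow> adj E y x"
  by (auto simp: adj_def insert_commute)

locale pendant_graph =
  fixes V :: "'a set" and E :: "'a set set" and n :: nat
  assumes simple: "simple_graph V E" and conn: "connected_graph V E"
    and card_E: "card E = n" and n_ge: "4 \<le> n"
    and bd_ne: "boundary V E \<noteq> {}"
begin

lemma finite_V: "finite V"
  using simple by (simp add: simple_graph_def)

lemma adj_in_V: "adj E x y \<Longrightarrow> x \<in> V \<and> y \<in> V"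
  using simple by (fastforce simp: adj_def simple_graph_def doubleton_eq_iff)

lemma edgeE:
  assumes "e \<in> E" obtains x y where "e = {x, y}" "adj E x y"
  using simple assms by (auto simp: adj_def simple_graph_def)

text \<open>A walk from s to t starts inside S and ends outside, so it has to cross.\<close>

lemma cut_edge:
  assumes "s \<in> S" "s \<in> V" "t \<in> V" "t \<notin> S"
  obtains x y where "x \<in> S" "y \<notin> S" "adj E x y"
proof -
  have "(s, t) \<in> {(u, v). adj E u v}\<^sup>*"
    using conn assms by (auto simp: connected_graph_def)
  \<comment> \<open>Along the walk, either the current vertex still lies in S or a crossing edge has
    already been met.\<close>
  then have "t \<notin> S \<longrightarrow> (\<exists>x y. x \<in> S \<and> y \<notin> S \<and> adj E x y)"
    by (induction rule: rtrancl_induct) (use assms in auto)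
  then show ?thesis using that assms by blast
qed

lemma neighbour_unique:
  assumes "x \<in> boundary V E" "adj E x y" "adj E x z"
  shows "y = z"
proof -
  have "card {y \<in> V. adj E x y} \<le> Suc 0"
    using assms by (simp add: boundary_def degree_def)
  then show ?thesis
    using assms adj_in_V finite_V by (subst (asm) card_le_Suc0_iff_eq) auto
qed

lemma boundary_neighbour:
  assumes "x \<in> boundary V E" obtains y where "adj E x y"
proof -
  have "card {y \<in> V. adj E x y} \<noteq> 0"
    using assms by (simp add: boundary_def degree_def)
  then have "{y \<in> V. adj E x y} \<noteq> {}" by fastforce
  then show ?thesis using that by blast
qed

text \<open>Two adjacent pendant vertices have no further neighbours, so by connectivity they are
  the whole graph; it would have one edge instead of at least four.\<close>

lemma boundary_not_adj:
  assumes x: "x \<in> boundary V E" and xy: "adj E x y"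
  shows "y \<notin> boundary V E"
proof
  assume y: "y \<in> boundary V E"
  have "V \<subseteq> {x, y}"
  proof
    fix t assume "t \<in> V"
    show "t \<in> {x, y}"
    proof (rule ccontr)
      assume "t \<notin> {x, y}"
      then obtain u v where uv: "u \<in> {x, y}" "v \<notin> {x, y}" "adj E u v"
        using cut_edge[of x "{x, y}" t] \<open>t \<in> V\<close> x by (auto simp: boundary_def)
      then show False
        using neighbour_unique[OF x xy, of v] neighbour_unique[OF y adj_sym[OF xy], of v] by auto
    qed
  qed
  have "e = {x, y}" if "e \<in> E" for e
  proof -
    obtain u v where e: "e = {u, v}" "adj E u v" using edgeE[OF \<open>e \<in> E\<close>] by blast
    then have "u \<in> {x, y}" "v \<in> {x, y}" "u \<noteq> v"
      using \<open>V \<subseteq> {x, y}\<close> adj_in_V by (auto simp: adj_def)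
    then show ?thesis using e by auto
  qed
  then have "E \<subseteq> {{x, y}}" by blast
  then have "card E \<le> 1" using card_mono[of "{{x, y}}" E] by simp
  then show False using card_E n_ge by simp
qed

lemma interior_nonempty: "V - boundary V E \<noteq> {}"
proof -
  obtain b where b: "b \<in> boundary V E" using bd_ne by blast
  obtain y where "adj E b y" using boundary_neighbour[OF b] .
  then show ?thesis using boundary_not_adj[OF b] adj_in_V by blast
qed

text \<open>Connectivity to a pendant vertex excludes degree 0, and being interior excludes degree
  1.\<close>

lemma degree_interior:
  assumes "x \<in> V - boundary V E" shows "2 \<le> degree V E x"
proof -
  obtain b where b: "b \<in> boundary V E" using bd_ne by blast
  then obtain u v where "u \<in> {x}" "v \<notin> {x}" "adj E u v"
    using cut_edge[of x "{x}" b] assms by (auto simp: boundary_def)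
  then have "degree V E x \<noteq> 0"
    using finite_V adj_in_V by (auto simp: degree_def)
  moreover have "degree V E x \<noteq> 1" using assms by (simp add: boundary_def)
  ultimately show ?thesis by simp
qed

lemma interior_two_neighbours:
  assumes "x \<in> V - boundary V E"
  obtains y z where "y \<noteq> z" "adj E x y" "adj E x z"
proof -
  have "\<not> card {y \<in> V. adj E x y} \<le> Suc 0"
    using degree_interior[OF assms] by (simp add: degree_def)
  then show ?thesis
    using that finite_V by (subst (asm) card_le_Suc0_iff_eq) auto
qed

text \<open>Handshake lemma: ordered adjacent pairs are counted once by first vertex and once by
  edge.\<close>

lemma sum_degree: "(\<Sum>x\<in>V. degree V E x) = 2 * n"
proof -
  let ?P = "SIGMA x:V. {y \<in> V. adj E x y}"
  let ?O = "\<lambda>e. {(x, y). e = {x, y} \<and> x \<noteq> y}"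
  have "(\<Sum>x\<in>V. degree V E x) = card ?P"
    using finite_V by (simp add: degree_def)
  also have "?P = (\<Union>e\<in>E. ?O e)"
    using adj_in_V by (auto simp: adj_def)
  also have "card \<dots> = (\<Sum>e\<in>E. card (?O e))"
  proof (rule card_UN_disjoint)
    show "finite E" using card_E n_ge card.infinite by fastforce
    show "\<forall>e\<in>E. finite (?O e)"
    proof
      fix e assume "e \<in> E"
      have "?O e \<subseteq> V \<times> V" using \<open>e \<in> E\<close> adj_in_V by (auto simp: adj_def)
      then show "finite (?O e)" using finite_V finite_subset by blast
    qed
  qed auto
  also have "\<dots> = (\<Sum>e\<in>E. 2)"
  proof (rule sum.cong)
    fix e assume "e \<in> E"
    then obtain x y where e: "e = {x, y}" "x \<noteq> y" using edgeE[of e] unfolding adj_def by blast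
    then have "?O e = {(x, y), (y, x)}" by (auto simp: doubleton_eq_iff)
    then show "card (?O e) = 2" using e by simp
  qed simp
  finally show ?thesis using card_E by simp
qed

text \<open>In the degree sum 2n every interior vertex takes at least 2 and the boundary takes a
  positive share. This is why the rearranged values fit on the tadpole with 0 left for vertex
  n.\<close>

lemma card_interior_less: "card (V - boundary V E) < n"
proof -
  have "boundary V E \<subseteq> V" by (auto simp: boundary_def)
  then have fb: "finite (boundary V E)" using finite_V finite_subset by blast
  have "2 * card (V - boundary V E) = (\<Sum>x\<in>V - boundary V E. 2)" by simp
  also have "\<dots> \<le> (\<Sum>x\<in>V - boundary V E. degree V E x)"
    by (intro sum_mono degree_interior)
  also have "\<dots> < (\<Sum>x\<in>V - boundary V E. degree V E x) + (\<Sum>x\<in>boundary V E. degree V E x)"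
    using bd_ne fb by (simp add: boundary_def card_gt_0_iff)
  also have "\<dots> = (\<Sum>x\<in>V. degree V E x)"
    using sum.subset_diff[OF \<open>boundary V E \<subseteq> V\<close> finite_V, of "degree V E"] by simp
  finally show ?thesis by (simp add: sum_degree)
qed

end

subsection \<open>The tadpole\<close>

definition tadpole_energy :: "real \<Rightarrow> nat \<Rightarrow> (nat \<Rightarrow> real) \<Rightarrow> real" where
  "tadpole_energy p n u =
     \<bar>u 1 - u 3\<bar> powr p + (\<Sum>j=1..<n. \<bar>u j - u (Suc j)\<bar> powr p)"

lemma adj_tadpole:
  "adj (tadpole_E n 3) i j \<longleftrightarrow>
     {i, j} = {1, 3} \<or> (1 \<le> i \<and> i < n \<and> j = Suc i) \<or> (1 \<le> j \<and> j < n \<and> i = Suc j)"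
  by (auto simp: adj_def tadpole_E_def doubleton_eq_iff)

lemma p_energy_tadpole:
  assumes "4 \<le> n"
  shows "p_energy p (tadpole_V n) (tadpole_E n 3) u = tadpole_energy p n u"
proof -
  let ?A = "{(x, y) \<in> tadpole_V n \<times> tadpole_V n. adj (tadpole_E n 3) x y \<and> x < y}"
  let ?w = "\<lambda>(x, y). \<bar>u x - u y\<bar> powr p"
  have "?A = insert (1, 3) ((\<lambda>j. (j, Suc j)) ` {1..<n})"
    using assms by (auto simp: adj_tadpole tadpole_V_def doubleton_eq_iff)
  moreover have "sum ?w (insert (1, 3) ((\<lambda>j. (j, Suc j)) ` {1..<n}))
      = ?w (1, 3) + sum ?w ((\<lambda>j. (j, Suc j)) ` {1..<n})"
    by (rule sum.insert) auto
  moreover have "sum ?w ((\<lambda>j. (j, Suc j)) ` {1..<n}) = (\<Sum>j=1..<n. \<bar>u j - u (Suc j)\<bar> powr p)"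
    by (subst sum.reindex) (auto simp: inj_on_def)
  moreover have "p_energy p (tadpole_V n) (tadpole_E n 3) u = sum ?w ?A"
    by (rule p_energy_oriented) (auto simp: tadpole_V_def adj_def)
  ultimately show ?thesis by (simp add: tadpole_energy_def)
qed

lemma boundary_tadpole_subset:
  assumes "4 \<le> n"
  shows "boundary (tadpole_V n) (tadpole_E n 3) \<subseteq> {n}"
proof
  fix x assume x: "x \<in> boundary (tadpole_V n) (tadpole_E n 3)"
  let ?N = "{y \<in> tadpole_V n. adj (tadpole_E n 3) x y}"
  have x1: "1 \<le> x" "x \<le> n" and c: "card ?N = 1"
    using x by (auto simp: boundary_def degree_def tadpole_V_def)
  show "x \<in> {n}"
  proof (rule ccontr)
    assume "x \<notin> {n}"
    \<comment> \<open>Apart from n, every vertex has its successor and its predecessor as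
      neighbours; vertex 1 has 3 in place of a predecessor.\<close>
    then have "\<exists>a b. a \<noteq> b \<and> {a, b} \<subseteq> ?N"
      using x1 assms
      by (intro exI[of _ "Suc x"] exI[of _ "if x = 1 then 3 else x - 1"])
         (auto simp: adj_tadpole tadpole_V_def)
    then obtain a b where ab: "a \<noteq> b" "{a, b} \<subseteq> ?N" by blast
    have "card {a, b} \<le> card ?N"
      by (rule card_mono[OF _ ab(2)]) (simp add: tadpole_V_def)
    then show False using ab c by simp
  qed
qed

text \<open>A set of n edges embedded in \<open>tadpole_E n i\<close> must fill it by this
  bound.\<close>

lemma card_tadpole_E_le: "0 < n \<Longrightarrow> finite (tadpole_E n i) \<and> card (tadpole_E n i) \<le> n"
proof -
  assume "0 < n"
  have eq: "tadpole_E n i = insert {1, i} ((\<lambda>k. {k, k + 1}) ` {1..<n})"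
    by (auto simp: tadpole_E_def)
  have "card (insert {1, i} ((\<lambda>k. {k, k + 1}) ` {1..<n})) \<le> Suc (card ((\<lambda>k. {k, k + 1}) ` {1..<n}))"
    by (rule card_insert_le_m1) simp_all
  also have "\<dots> \<le> Suc (card {1..<n})" using card_image_le by fastforce
  finally show ?thesis using eq \<open>0 < n\<close> by simp
qed

text \<open>Raising a minimiser by t on {1..j}, or on one or both vertices of the triangle away from the
  tail, gains norm linearly in t but costs energy of order t powr p wherever a gap vanishes.\<close>

lemma tadpole_minimiser_strictly_decreasing:
  fixes g :: "nat \<Rightarrow> real"
  assumes p: "1 < p" and n: "4 \<le> n"
    and min: "\<And>u. u n = 0 \<Longrightarrow> L * (\<Sum>j=1..n. \<bar>u j\<bar> powr p) \<le> tadpole_energy p n u"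
    and eq: "tadpole_energy p n g = L * (\<Sum>j=1..n. \<bar>g j\<bar> powr p)"
    and anti: "\<And>i j. 1 \<le> i \<Longrightarrow> i \<le> j \<Longrightarrow> g j \<le> g i"
    and gn: "g n = 0" and g1: "0 < g 1"
    and j: "2 \<le> j" "j < n"
  shows "g (Suc j) < g j"
proof -
  have nn: "0 \<le> g i" if "1 \<le> i" "i \<le> n" for i using anti[OF that] gn by simp
  have "0 < tadpole_energy p n g"
  proof -
    \<comment> \<open>g falls from a positive value at 1 to 0 at n, so some gap is nonzero. The
      energy, and with it L, is therefore positive.\<close>
    have "\<exists>i\<in>{1..<n}. g i \<noteq> g (Suc i)"
    proof (rule ccontr)
      assume "\<not> ?thesis"
      then have c: "g (Suc i) = g i" if "1 \<le> i" "i < n" for i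
        using that by (metis atLeastLessThan_iff)
      have "g m = g 1" if "1 \<le> m" "m \<le> n" for m
        using that by (induction m rule: dec_induct) (simp_all add: c)
      from this[of n] show False using gn g1 n by simp
    qed
    then obtain i where i: "i \<in> {1..<n}" "g i \<noteq> g (Suc i)" by blast
    then have "0 < (\<Sum>j=1..<n. \<bar>g j - g (Suc j)\<bar> powr p)"
      by (intro sum_pos2[of _ i]) auto
    then show ?thesis by (simp add: tadpole_energy_def add_nonneg_pos)
  qed
  moreover have "0 \<le> (\<Sum>j=1..n. \<bar>g j\<bar> powr p)" by (intro sum_nonneg) auto
  ultimately have L: "0 < L" unfolding eq by (simp add: zero_less_mult_iff)
  \<comment> \<open>Raising g by t on S lowers no summand of the norm, and the one at s grows by at
    least \<open>t * g s powr (p - 1)\<close>. Since S avoids n, minimality converts this gain into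
    a lower bound for the growth of the energy.\<close>
  have key: "L * g s powr (p - 1) * t \<le>
      tadpole_energy p n (\<lambda>i. g i + (if i \<in> S then t else 0)) - tadpole_energy p n g"
    if S: "S \<subseteq> {1..<n}" "s \<in> S" and t: "0 < t" for S s t
  proof -
    let ?u = "\<lambda>i. g i + (if i \<in> S then t else 0)"
    have s: "s \<in> {1..n}" "0 \<le> g s" using S nn[of s] by auto
    have "t * g s powr (p - 1) = (\<Sum>i=1..n. if i = s then t * g s powr (p - 1) else 0)"
      using s by (simp add: sum.delta)
    also have "\<dots> \<le> (\<Sum>i=1..n. \<bar>?u i\<bar> powr p - \<bar>g i\<bar> powr p)"
    proof (rule sum_mono)
      fix i assume i: "i \<in> {1..n}"
      then have gi: "0 \<le> g i" using nn by simp
      have "\<bar>g i\<bar> powr p \<le> \<bar>?u i\<bar> powr p" using gi t p by (intro powr_mono2) auto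
      moreover have "g s powr p + t * g s powr (p - 1) \<le> (g s + t) powr p"
        using powr_add_ge_linear s t p by simp
      ultimately show "(if i = s then t * g s powr (p - 1) else 0) \<le> \<bar>?u i\<bar> powr p - \<bar>g i\<bar> powr p"
        using S s t by auto
    qed
    finally have "t * g s powr (p - 1) \<le> (\<Sum>i=1..n. \<bar>?u i\<bar> powr p) - (\<Sum>i=1..n. \<bar>g i\<bar> powr p)"
      by (simp add: sum_subtractf)
    from mult_left_mono[OF this, of L] have "L * (t * g s powr (p - 1)) \<le>
        L * (\<Sum>i=1..n. \<bar>?u i\<bar> powr p) - tadpole_energy p n g"
      using L eq by (simp add: right_diff_distrib)
    moreover have "L * (\<Sum>i=1..n. \<bar>?u i\<bar> powr p) \<le> tadpole_energy p n ?u"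
      using S gn by (intro min) auto
    ultimately show ?thesis by (simp add: ac_simps)
  qed
  \<comment> \<open>Lifting all of \<open>{1..i}\<close> by t alters one gap only, the one after i,
    which was 0 and becomes t.\<close>
  have tail: "g (Suc i) < g i" if i: "3 \<le> i" "i < n" for i
  proof (rule ccontr)
    assume "\<not> ?thesis"
    then have gi: "g i = g (Suc i)" using anti[of i "Suc i"] i by simp
    show False
    proof (rule linear_not_bounded_by_powr[of "L * g 1 powr (p - 1)" 1 1 p])
      fix t :: real assume t: "0 < t" "t \<le> 1"
      let ?u = "\<lambda>m. g m + (if m \<in> {1..i} then t else 0)"
      have "(\<Sum>j=1..<n. \<bar>?u j - ?u (Suc j)\<bar> powr p)
          = (\<Sum>j=1..<n. \<bar>g j - g (Suc j)\<bar> powr p + (if j = i then t powr p else 0))"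
        using gi t by (intro sum.cong) auto
      also have "\<dots> = (\<Sum>j=1..<n. \<bar>g j - g (Suc j)\<bar> powr p) + t powr p"
        using i by (simp add: sum.distrib)
      finally have "tadpole_energy p n ?u - tadpole_energy p n g = t powr p"
        using i by (simp add: tadpole_energy_def)
      moreover have "{1..i} \<subseteq> {1..<n}" using i by auto
      ultimately show "L * g 1 powr (p - 1) * t \<le> 1 * t powr p"
        using key[of "{1..i}" 1 t] i t by simp
    qed (use L g1 p in auto)
  qed
  have split: "tadpole_energy p n u = \<bar>u 1 - u 3\<bar> powr p + \<bar>u 1 - u 2\<bar> powr p + \<bar>u 2 - u 3\<bar> powr p
      + (\<Sum>j=3..<n. \<bar>u j - u (Suc j)\<bar> powr p)" for u
    using n by (simp add: tadpole_energy_def sum.atLeast_Suc_lessThan numeral_eq_Suc)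
  have "g 3 < g 2"
  proof (rule ccontr)
    assume "\<not> ?thesis"
    then have g23: "g 2 = g 3" using anti[of 2 3] by simp
    \<comment> \<open>The strict drop after 3 gives positivity, so the slope
      \<open>g 2 powr (p - 1)\<close> used below is not 0.\<close>
    have g3: "0 < g 3" using tail[of 3] n nn[of 4] by (simp add: numeral_eq_Suc)
    have g12: "g 2 \<le> g 1" using anti[of 1 2] by simp
    show False
    proof (cases "g 1 = g 2")
      case True
      \<comment> \<open>The triangle is level here. Lifting 1 and 2 together leaves their edge at 0
        and opens both edges to 3, which accounts for the constant 2.\<close>
      show False
      proof (rule linear_not_bounded_by_powr[of "L * g 1 powr (p - 1)" 2 1 p])
        fix t :: real assume t: "0 < t" "t \<le> 1"
        show "L * g 1 powr (p - 1) * t \<le> 2 * t powr p"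
          using key[of "{1, 2}" 1 t] True t n g23 unfolding split by simp
      qed (use L g1 p in auto)
    next
      case False
      \<comment> \<open>Lifting 2 alone opens only its edge to 3. The restriction
        \<open>t \<le> g 1 - g 2\<close> keeps the raised value at most \<open>g 1\<close>, so the
        edge between 1 and 2 does not get dearer.\<close>
      show False
      proof (rule linear_not_bounded_by_powr[of "L * g 2 powr (p - 1)" 1 "g 1 - g 2" p])
        fix t :: real assume t: "0 < t" "t \<le> g 1 - g 2"
        have "\<bar>g 1 - (g 2 + t)\<bar> powr p \<le> \<bar>g 1 - g 2\<bar> powr p"
          using t p by (intro powr_mono2) auto
        then show "L * g 2 powr (p - 1) * t \<le> 1 * t powr p"
          using key[of "{2}" 2 t] t n g23 unfolding split by simp
      qed (use L g3 g23 g12 False p in auto)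
    qed
  qed
  then show ?thesis using tail[of j] j by (cases "j = 2") (auto simp: numeral_eq_Suc)
qed

subsection \<open>Rearrangement onto the tadpole\<close>

text \<open>An edge between ranks i and l charges its part above rank 3 to the triangle and its part below
  rank 3 to the successive gaps of the tail.\<close>

definition split_cost :: "real \<Rightarrow> (nat \<Rightarrow> real) \<Rightarrow> nat \<Rightarrow> nat \<Rightarrow> real" where
  "split_cost p g i l = (g (min i 3) - g (min l 3)) powr p
     + (\<Sum>j=max i 3..<max l 3. (g j - g (Suc j)) powr p)"

text \<open>Superadditivity is used twice: to merge the tail gaps into one difference, then to add
  the parts above and below rank 3.\<close>

lemma split_cost_le:
  assumes "1 \<le> p" "1 \<le> i" "i \<le> l"
    and anti: "\<And>i j. 1 \<le> i \<Longrightarrow> i \<le> j \<Longrightarrow> g j \<le> g i"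
  shows "split_cost p g i l \<le> (g i - g l) powr p"
proof -
  have *: "g (max l 3) \<le> g (max i 3)" "(\<Sum>j=max i 3..<max l 3. (g j - g (Suc j)) powr p)
      \<le> (g (max i 3) - g (max l 3)) powr p"
    using sum_powr_gaps_le[of p "max i 3" "max l 3" g] assms by auto
  have "split_cost p g i l \<le> (g (min i 3) - g (min l 3)) powr p + (g (max i 3) - g (max l 3)) powr p"
    using * by (simp add: split_cost_def)
  also have "\<dots> \<le> ((g (min i 3) - g (min l 3)) + (g (max i 3) - g (max l 3))) powr p"
    using assms * by (intro powr_add_superadditive) (auto intro!: anti)
  also have "(g (min i 3) - g (min l 3)) + (g (max i 3) - g (max l 3)) = g i - g l"
    using \<open>i \<le> l\<close> by (auto simp: min_def max_def)
  finally show ?thesis .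
qed

text \<open>An edge ending at \<open>Suc l\<close> that skips rank l contains two positive pieces,
  above l and below l, where superadditivity is strict.\<close>

lemma split_cost_less:
  assumes "1 < p" "1 \<le> i" "i < l" "3 \<le> l"
    and anti: "\<And>i j. 1 \<le> i \<Longrightarrow> i \<le> j \<Longrightarrow> g j \<le> g i"
    and "g l < g i" "g (Suc l) < g l"
  shows "split_cost p g i (Suc l) < (g i - g (Suc l)) powr p"
proof -
  have "split_cost p g i (Suc l) = split_cost p g i l + (g l - g (Suc l)) powr p"
    using assms by (simp add: split_cost_def min_def max_def)
  also have "\<dots> \<le> (g i - g l) powr p + (g l - g (Suc l)) powr p"
    using split_cost_le[of p i l g] assms by simp
  also have "\<dots> < ((g i - g l) + (g l - g (Suc l))) powr p"
    using assms by (intro powr_add_strict_superadditive) auto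
  finally show ?thesis by simp
qed

text \<open>All pendant vertices share the label n, so h need not be injective on V. Labels strictly
  between k and n are held by no vertex, and g is 0 there.\<close>

locale ranked_graph = pendant_graph +
  fixes p :: real and h :: "'a \<Rightarrow> nat" and g :: "nat \<Rightarrow> real" and k :: nat
  assumes p_gt: "1 < p"
    and h_interior: "bij_betw h (V - boundary V E) {1..k}"
    and h_boundary: "\<And>x. x \<in> boundary V E \<Longrightarrow> h x = n"
    and k_less: "k < n"
    and anti: "\<And>i j. 1 \<le> i \<Longrightarrow> i \<le> j \<Longrightarrow> g j \<le> g i"
    and zero: "\<And>j. k < j \<Longrightarrow> g j = 0"
begin

abbreviation edges_up :: "('a \<times> 'a) set" where
  "edges_up \<equiv> {(x, y) \<in> V \<times> V. adj E x y \<and> h x < h y}"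

lemma finite_edges_up: "finite edges_up"
  using finite_V by (auto intro: finite_subset[of _ "V \<times> V"])

lemma boundary_subset: "boundary V E \<subseteq> V"
  by (auto simp: boundary_def)

lemma h_range: "x \<in> V \<Longrightarrow> 1 \<le> h x \<and> h x \<le> n"
  using bij_betwE[OF h_interior] h_boundary[of x] k_less n_ge by (cases "x \<in> boundary V E") force+

lemma h_interior_le: "x \<in> V - boundary V E \<Longrightarrow> h x \<le> k"
  using bij_betwE[OF h_interior] by auto

lemma k_ge: "1 \<le> k"
  using interior_nonempty bij_betwE[OF h_interior] by fastforce

lemma rank_vertex:
  assumes "1 \<le> i" "i \<le> k"
  obtains v where "v \<in> V - boundary V E" "h v = i"
  using assms bij_betw_imp_surj_on[OF h_interior] by (metis (no_types) atLeastAtMost_iff imageE)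

lemma h_eqD:
  assumes "x \<in> V" "y \<in> V" "h x = h y" "h x \<noteq> n"
  shows "x = y"
  using assms h_boundary[of x] h_boundary[of y] bij_betw_imp_inj_on[OF h_interior]
  by (auto dest!: inj_onD)

text \<open>Only the label n can be shared, and its holders are pendant vertices, which are never
  adjacent to each other.\<close>

lemma h_adj_neq:
  assumes "adj E x y" shows "h x \<noteq> h y"
proof
  assume eq: "h x = h y"
  have V: "x \<in> V" "y \<in> V" and "x \<noteq> y" using assms adj_in_V by (auto simp: adj_def)
  then have "h x = n" using h_eqD eq by blast
  then have "x \<in> boundary V E" "y \<in> boundary V E"
    using V eq h_interior_le[of x] h_interior_le[of y] k_less by auto
  then show False using boundary_not_adj[OF _ assms] by blast
qed

lemma edges_upI: "adj E x y \<Longrightarrow> h x < h y \<Longrightarrow> (x, y) \<in> edges_up"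
  using adj_in_V by simp

text \<open>The vertices of label at most j include the one ranked 1 and exclude the pendant ones,
  so connectivity supplies a crossing edge.\<close>

lemma level_cut:
  assumes "1 \<le> j" "j < n"
  shows "\<exists>e\<in>edges_up. h (fst e) \<le> j \<and> j < h (snd e)"
proof -
  obtain v where v: "v \<in> V - boundary V E" "h v = 1" using rank_vertex[of 1] k_ge by auto
  obtain b where b: "b \<in> boundary V E" using bd_ne by blast
  obtain x y where xy: "x \<in> {x. h x \<le> j}" "y \<notin> {x. h x \<le> j}" "adj E x y"
    using cut_edge[of v "{x. h x \<le> j}" b] v b h_boundary[OF b] boundary_subset assms by auto
  then show ?thesis using edges_upI[of x y] by (intro bexI[of _ "(x, y)"]) auto
qed

lemma energy_edges_up:
  "p_energy p V E (g \<circ> h) = (\<Sum>(x, y)\<in>edges_up. (g (h x) - g (h y)) powr p)"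
proof -
  have "p_energy p V E (g \<circ> h) = (\<Sum>(x, y)\<in>edges_up. \<bar>(g \<circ> h) x - (g \<circ> h) y\<bar> powr p)"
    using finite_V h_adj_neq by (intro p_energy_oriented)
  also have "\<dots> = (\<Sum>(x, y)\<in>edges_up. (g (h x) - g (h y)) powr p)"
  proof (rule sum.cong)
    fix e assume "e \<in> edges_up"
    then have "g (h (snd e)) \<le> g (h (fst e))" using h_range by (intro anti) auto
    then show "(case e of (x, y) \<Rightarrow> \<bar>(g \<circ> h) x - (g \<circ> h) y\<bar> powr p)
        = (case e of (x, y) \<Rightarrow> (g (h x) - g (h y)) powr p)"
      by (simp add: case_prod_unfold)
  qed simp
  finally show ?thesis .
qed

definition cuts :: "nat \<Rightarrow> ('a \<times> 'a) set" where
  "cuts j = {e \<in> edges_up. h (fst e) \<le> j \<and> j < h (snd e)}"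

lemma finite_cuts: "finite (cuts j)"
  unfolding cuts_def using finite_edges_up by simp

lemma card_cuts_pos:
  assumes "1 \<le> j" "j < n" shows "1 \<le> card (cuts j)"
proof -
  have "cuts j \<noteq> {}" using level_cut[OF assms] unfolding cuts_def by blast
  then have "0 < card (cuts j)" using finite_cuts by (simp add: card_gt_0_iff)
  then show ?thesis by simp
qed

text \<open>The share charged to the triangle. Clamping labels at 3 makes edges lying entirely
  beyond rank 3 free, as \<open>0 powr p = 0\<close>.\<close>

definition top_cost :: "'a \<times> 'a \<Rightarrow> real" where
  "top_cost e = (g (min (h (fst e)) 3) - g (min (h (snd e)) 3)) powr p"

text \<open>Exchanging the two summations charges each tail gap once per edge that cuts it.\<close>

lemma sum_split_cost:
  "(\<Sum>(x, y)\<in>edges_up. split_cost p g (h x) (h y))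
    = sum top_cost edges_up + (\<Sum>j=3..<n. card (cuts j) * (g j - g (Suc j)) powr p)"
proof -
  have cut:  "(\<Sum>e\<in>edges_up. if e \<in> cuts j then (g j - g (Suc j)) powr p else 0)
      = card (cuts j) * (g j - g (Suc j)) powr p" for j
  proof -
    have "(\<Sum>e\<in>edges_up. if e \<in> cuts j then (g j - g (Suc j)) powr p else 0)
        = (\<Sum>e\<in>{e \<in> edges_up. e \<in> cuts j}. (g j - g (Suc j)) powr p)"
      by (rule sum.inter_filter[symmetric, OF finite_edges_up])
    also have "{e \<in> edges_up. e \<in> cuts j} = cuts j" by (auto simp: cuts_def)
    finally show ?thesis by simp
  qed
  have "(\<Sum>(x, y)\<in>edges_up. split_cost p g (h x) (h y)) = (\<Sum>e\<in>edges_up. top_cost e +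
      (\<Sum>j=3..<n. if e \<in> cuts j then (g j - g (Suc j)) powr p else 0))"
  proof (rule sum.cong)
    fix e assume e: "e \<in> edges_up"
    then have hn: "h (snd e) \<le> n" using h_range by auto
    have "(\<Sum>j=3..<n. if e \<in> cuts j then (g j - g (Suc j)) powr p else 0)
        = (\<Sum>j\<in>{j \<in> {3..<n}. e \<in> cuts j}. (g j - g (Suc j)) powr p)"
      by (rule sum.inter_filter[symmetric]) simp
    also have "{j \<in> {3..<n}. e \<in> cuts j} = {max (h (fst e)) 3..<max (h (snd e)) 3}"
      using e hn by (auto simp: cuts_def)
    finally show "(case e of (x, y) \<Rightarrow> split_cost p g (h x) (h y)) = top_cost e +
        (\<Sum>j=3..<n. if e \<in> cuts j then (g j - g (Suc j)) powr p else 0)"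
      by (simp add: split_cost_def top_cost_def case_prod_unfold)
  qed simp
  also have "\<dots> = sum top_cost edges_up +
      (\<Sum>j=3..<n. \<Sum>e\<in>edges_up. if e \<in> cuts j then (g j - g (Suc j)) powr p else 0)"
    by (simp only: sum.distrib sum.swap[of _ _ edges_up])
  finally show ?thesis by (simp only: cut)
qed

text \<open>Three distinct edges pay for the triangle: two at the vertex of rank 1, of which at most
  one ends at rank 2, and one from the vertex of rank 2 to a rank of at least 3.\<close>

lemma sum_top_cost_ge:
  "(g 1 - g 2) powr p + (g 1 - g 3) powr p + (g 2 - g 3) powr p \<le> sum top_cost edges_up"
proof -
  have g: "g 2 \<le> g 1" "g 3 \<le> g 2" using anti[of 1 2] anti[of 2 3] by auto
  have ge: "sum top_cost S \<le> sum top_cost edges_up" if "S \<subseteq> edges_up" for S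
    using finite_edges_up that by (intro sum_mono2) (auto simp: top_cost_def)
  obtain v where v: "v \<in> V - boundary V E" "h v = 1" using rank_vertex[of 1] k_ge by auto
  have up: "(v, y) \<in> edges_up \<and> (h y = 2 \<or> 3 \<le> h y)" if "adj E v y" for y
  proof -
    have "1 \<le> h y" "h y \<noteq> 1" using h_range h_adj_neq[OF that] adj_in_V[OF that] v by auto
    then show ?thesis using edges_upI[OF that] v by auto
  qed
  \<comment> \<open>Rank 2 is held by at most one vertex because it differs from n; z is named as
    the neighbour that avoids it.\<close>
  obtain y z where yz: "adj E v y" "adj E v z" "y \<noteq> z" "3 \<le> h z"
  proof -
    obtain y z where "y \<noteq> z" "adj E v y" "adj E v z" using interior_two_neighbours[OF v(1)] .
    moreover from this have "h y \<noteq> 2 \<or> h z \<noteq> 2"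
      using h_eqD[of y z] adj_in_V n_ge by auto
    ultimately show ?thesis using that[of y z] that[of z y] up[of y] up[of z] by auto
  qed
  have z: "top_cost (v, z) = (g 1 - g 3) powr p" using v yz by (simp add: top_cost_def)
  have y: "(g 1 - g 2) powr p \<le> top_cost (v, y)"
    using up[OF yz(1)] v g p_gt by (auto simp: top_cost_def intro!: powr_mono2)
  show ?thesis
  proof (cases "2 \<le> k")
    case True
    then obtain w where w: "w \<in> V - boundary V E" "h w = 2" using rank_vertex[of 2] by auto
    have "w \<noteq> v" using w v by auto
    obtain a b where ab: "a \<noteq> b" "adj E w a" "adj E w b"
      using interior_two_neighbours[OF w(1)] .
    have "h a \<noteq> 1 \<or> h b \<noteq> 1" using h_eqD[of a b] ab adj_in_V n_ge by auto
    then obtain c where c: "adj E w c" "h c \<noteq> 1" using ab by blast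
    then have c3: "3 \<le> h c" using h_adj_neq[OF c(1)] h_range[of c] adj_in_V[OF c(1)] w by auto
    have "sum top_cost {(v, y), (v, z), (w, c)} \<le> sum top_cost edges_up"
      using up[OF yz(1)] up[OF yz(2)] edges_upI[OF c(1)] w c3 by (intro ge) auto
    moreover have "top_cost (w, c) = (g 2 - g 3) powr p" using w c3 by (simp add: top_cost_def)
    ultimately show ?thesis using y z yz \<open>w \<noteq> v\<close> by simp
  next
    case False
    \<comment> \<open>With a single interior vertex nothing has rank 2, but the third side of the
      triangle then costs 0.\<close>
    then have "g 2 = 0" "g 3 = 0" using zero by auto
    moreover have "sum top_cost {(v, y), (v, z)} \<le> sum top_cost edges_up"
      using up[OF yz(1)] up[OF yz(2)] by (intro ge) auto
    ultimately show ?thesis using y z yz by simp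
  qed
qed

lemma tadpole_energy_eq:
  "tadpole_energy p n g = (g 1 - g 2) powr p + (g 1 - g 3) powr p + (g 2 - g 3) powr p
     + (\<Sum>j=3..<n. (g j - g (Suc j)) powr p)"
proof -
  have "g 2 \<le> g 1" "g 3 \<le> g 2" using anti[of 1 2] anti[of 2 3] by auto
  moreover have "(\<Sum>j=3..<n. \<bar>g j - g (Suc j)\<bar> powr p) = (\<Sum>j=3..<n. (g j - g (Suc j)) powr p)"
    using anti by (intro sum.cong) auto
  ultimately show ?thesis using n_ge
    by (simp add: tadpole_energy_def sum.atLeast_Suc_lessThan numeral_eq_Suc)
qed

lemma edge_cost_le:
  "e \<in> edges_up \<Longrightarrow> (case e of (x, y) \<Rightarrow> split_cost p g (h x) (h y))
     \<le> (case e of (x, y) \<Rightarrow> (g (h x) - g (h y)) powr p)"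
  using h_range p_gt by (auto intro!: split_cost_le anti)

lemma cuts_cost_le:
  "j \<in> {3..<n} \<Longrightarrow> (g j - g (Suc j)) powr p \<le> card (cuts j) * (g j - g (Suc j)) powr p"
  using card_cuts_pos[of j] mult_right_mono[of 1 "real (card (cuts j))" "(g j - g (Suc j)) powr p"]
  by simp

text \<open>Slack can arise in three places: splitting an edge, cutting a tail gap more than once,
  and the triangle. The first two are exploited in the equality case.\<close>

lemma tadpole_energy_le: "tadpole_energy p n g \<le> p_energy p V E (g \<circ> h)"
proof -
  have "tadpole_energy p n g \<le> (\<Sum>(x, y)\<in>edges_up. split_cost p g (h x) (h y))"
    unfolding tadpole_energy_eq sum_split_cost
    by (intro add_mono sum_top_cost_ge sum_mono cuts_cost_le)
  also have "\<dots> \<le> p_energy p V E (g \<circ> h)"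
    unfolding energy_edges_up by (intro sum_mono edge_cost_le)
  finally show ?thesis .
qed

text \<open>Pendant vertices and labels beyond k contribute 0, so both sums reduce to the ranks
  \<open>{1..k}\<close>.\<close>

lemma norm_eq: "p_norm_pow p V (g \<circ> h) = (\<Sum>j=1..n. \<bar>g j\<bar> powr p)"
proof -
  have "p_norm_pow p V (g \<circ> h) = (\<Sum>x\<in>V - boundary V E. \<bar>(g \<circ> h) x\<bar> powr p)"
    unfolding p_norm_pow_def using finite_V h_boundary zero k_less
    by (intro sum.mono_neutral_right) auto
  also have "\<dots> = (\<Sum>j=1..k. \<bar>g j\<bar> powr p)"
    using sum.reindex_bij_betw[OF h_interior, of "\<lambda>j. \<bar>g j\<bar> powr p"] by simp
  also have "\<dots> = (\<Sum>j=1..n. \<bar>g j\<bar> powr p)"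
    using zero k_less by (intro sum.mono_neutral_left) auto
  finally show ?thesis .
qed

section \<open>The equality case\<close>

lemma iso_tadpole_if_equality:
  assumes eq: "tadpole_energy p n g = p_energy p V E (g \<circ> h)"
    and dec: "\<And>j. 2 \<le> j \<Longrightarrow> j < n \<Longrightarrow> g (Suc j) < g j"
  shows "graph_iso V E (tadpole_V n) (tadpole_E n 3)"
proof -
  \<comment> \<open>A smaller k would give g the value 0 at both n - 1 and n, against the strict
    decrease.\<close>
  have k: "k = n - 1"
  proof (rule ccontr)
    assume "k \<noteq> n - 1"
    then have "g (n - 1) = 0" "g n = 0" using zero k_less by auto
    moreover have "2 \<le> n - 1" "n - 1 < n" using n_ge by auto
    ultimately show False using dec[of "n - 1"] n_ge by simp
  qed
  \<comment> \<open>The condition \<open>3 \<le> l\<close> matters: \<open>g 1 = g 2\<close> has not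
    been excluded.\<close>
  have less: "g l < g i" if "1 \<le> i" "i < l" "3 \<le> l" "l \<le> n" for i l
  proof -
    have "g l < g (l - 1)" using dec[of "l - 1"] that by simp
    also have "g (l - 1) \<le> g i" using that by (intro anti) auto
    finally show ?thesis .
  qed
  \<comment> \<open>An edge reaching label 4 or more while skipping a rank would lose strictly in
    its split. The chord from 1 to 3 stays allowed.\<close>
  have step: "h y = Suc (h x)" if e: "(x, y) \<in> edges_up" "4 \<le> h y" for x y
  proof (rule ccontr)
    assume c: "h y \<noteq> Suc (h x)"
    define l where "l = h y - 1"
    have l: "h y = Suc l" "3 \<le> l" "h x < l" "1 \<le> h x" "l < n"
      using e c h_range[of x] h_range[of y] by (auto simp: l_def)
    have "split_cost p g (h x) (h y) < (g (h x) - g (h y)) powr p"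
      unfolding l(1) using l p_gt less[of "h x" l] dec[of l]
      by (intro split_cost_less anti) auto
    then have "(\<Sum>(x, y)\<in>edges_up. split_cost p g (h x) (h y)) < p_energy p V E (g \<circ> h)"
      unfolding energy_edges_up using e
      by (intro sum_strict_mono_ex1 finite_edges_up ballI edge_cost_le)
         (auto intro!: bexI[of _ "(x, y)"])
    moreover have "tadpole_energy p n g \<le> (\<Sum>(x, y)\<in>edges_up. split_cost p g (h x) (h y))"
      unfolding tadpole_energy_eq sum_split_cost
      by (intro add_mono sum_top_cost_ge sum_mono cuts_cost_le)
    ultimately show False using eq by simp
  qed
  \<comment> \<open>A second edge across the last gap, which is positive, would be paid for
    twice.\<close>
  have one: "card (cuts (n - 1)) \<le> Suc 0"
  proof (rule ccontr)
    assume c: "\<not> ?thesis"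
    have "2 \<le> n - 1" "n - 1 < n" using n_ge by auto
    from dec[OF this] have "0 < (g (n - 1) - g (Suc (n - 1))) powr p" by simp
    then have "(g (n - 1) - g (Suc (n - 1))) powr p
        < card (cuts (n - 1)) * (g (n - 1) - g (Suc (n - 1))) powr p"
      using c by simp
    then have "(\<Sum>j=3..<n. (g j - g (Suc j)) powr p)
        < (\<Sum>j=3..<n. card (cuts j) * (g j - g (Suc j)) powr p)"
      using n_ge by (intro sum_strict_mono_ex1 ballI cuts_cost_le) (auto intro!: bexI[of _ "n - 1"])
    then have "tadpole_energy p n g < (\<Sum>(x, y)\<in>edges_up. split_cost p g (h x) (h y))"
      unfolding tadpole_energy_eq sum_split_cost by (intro add_le_less_mono sum_top_cost_ge)
    also have "\<dots> \<le> p_energy p V E (g \<circ> h)"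
      unfolding energy_edges_up by (intro sum_mono edge_cost_le)
    finally show False using eq by simp
  qed
  \<comment> \<open>Each pendant vertex is the end of its own edge across the last gap, so there is
    just one, and h becomes injective.\<close>
  have bd1: "x = y" if xy: "x \<in> boundary V E" "y \<in> boundary V E" for x y
  proof -
    have "\<exists>u. (u, x) \<in> cuts (n - 1)" if x: "x \<in> boundary V E" for x
    proof -
      obtain u where u: "adj E x u" using boundary_neighbour[OF x] .
      have "u \<in> V - boundary V E" using boundary_not_adj[OF x u] adj_in_V[OF u] by simp
      then have "h u \<le> n - 1" using h_interior_le k by blast
      then show ?thesis
        using edges_upI[OF adj_sym[OF u]] h_boundary[OF x] n_ge
        by (intro exI[of _ u]) (auto simp: cuts_def)
    qed
    then obtain u v where "(u, x) \<in> cuts (n - 1)" "(v, y) \<in> cuts (n - 1)" using xy by blast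
    then show ?thesis
      using one card_le_Suc0_iff_eq[OF finite_cuts[of "n - 1"]] by blast
  qed
  have inj: "inj_on h V"
  proof (rule inj_onI)
    fix x y assume xy: "x \<in> V" "y \<in> V" "h x = h y"
    show "x = y"
    proof (cases "h x = n")
      case True
      then have "x \<in> boundary V E" "y \<in> boundary V E"
        using xy h_interior_le[of x] h_interior_le[of y] k_less by auto
      then show ?thesis using bd1 by blast
    next
      case False
      then show ?thesis using h_eqD xy by blast
    qed
  qed
  have im: "h ` V = tadpole_V n"
  proof -
    have "V = (V - boundary V E) \<union> boundary V E" using boundary_subset by blast
    then have "h ` V = h ` (V - boundary V E) \<union> h ` boundary V E" by (metis image_Un)
    also have "h ` (V - boundary V E) = {1..n - 1}" using h_interior k by (simp add: bij_betw_def)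
    also have "h ` boundary V E = {n}" using h_boundary bd_ne by auto
    finally show ?thesis using n_ge by (auto simp: tadpole_V_def)
  qed
  have up: "{h x, h y} \<in> tadpole_E n 3" if e: "(x, y) \<in> edges_up" for x y
  proof (cases "4 \<le> h y")
    case True
    then have "h y = Suc (h x)" using step e by blast
    moreover have "1 \<le> h x" "h y \<le> n" using h_range e by auto
    ultimately show ?thesis by (auto simp: tadpole_E_def)
  next
    case False
    moreover have "1 \<le> h x" "h x < h y" using h_range e by auto
    ultimately have "h y = Suc (h x) \<or> h x = 1 \<and> h y = 3" by linarith
    moreover have "h y \<le> n" using h_range e by auto
    ultimately show ?thesis using \<open>1 \<le> h x\<close> by (auto simp: tadpole_E_def)
  qed
  have sub: "(`) h ` E \<subseteq> tadpole_E n 3"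
  proof
    fix a assume "a \<in> (`) h ` E"
    then obtain e where e: "e \<in> E" "a = h ` e" by blast
    obtain x y where xy: "e = {x, y}" "adj E x y" using edgeE[OF e(1)] .
    then show "a \<in> tadpole_E n 3"
      using up[of x y] up[of y x] h_adj_neq[OF xy(2)] edges_upI[OF xy(2)]
        edges_upI[OF adj_sym[OF xy(2)]] e by (cases "h x < h y") (auto simp: insert_commute)
  qed
  have EV: "e \<subseteq> V" if "e \<in> E" for e
    using edgeE[OF that] adj_in_V by (metis insert_subset empty_subsetI)
  have injE: "inj_on ((`) h) E"
    using inj EV by (auto intro!: inj_onI simp: inj_on_image_eq_iff)
  \<comment> \<open>The n edges of G map injectively into a set of at most n edges, so the inclusion
    is an equality.\<close>
  have "(`) h ` E = tadpole_E n 3"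
  proof (rule card_subset_eq[OF _ sub])
    have c: "finite (tadpole_E n 3)" "card (tadpole_E n 3) \<le> n"
      using card_tadpole_E_le[of n 3] n_ge by auto
    then show "finite (tadpole_E n 3)" by simp
    show "card ((`) h ` E) = card (tadpole_E n 3)"
      using c card_mono[OF c(1) sub] card_image[OF injE] card_E by simp
  qed
  moreover have "{x, y} \<in> E" if xy: "x \<in> V" "y \<in> V" "{h x, h y} \<in> (`) h ` E" for x y
  proof -
    obtain e where e: "e \<in> E" "h ` e = h ` {x, y}" using xy(3) by auto
    then have "e = {x, y}" using inj_on_image_eq_iff[OF inj EV[OF e(1)], of "{x, y}"] xy by simp
    then show ?thesis using e by simp
  qed
  moreover have "{h x, h y} \<in> (`) h ` E" if "{x, y} \<in> E" for x y
    using imageI[OF that, of "(`) h"] by simp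
  ultimately have "\<forall>x\<in>V. \<forall>y\<in>V. {x, y} \<in> E \<longleftrightarrow> {h x, h y} \<in> tadpole_E n 3" by metis
  moreover have "bij_betw h V (tadpole_V n)" using inj im by (simp add: bij_betw_def)
  ultimately show ?thesis unfolding graph_iso_def by (intro exI[of _ h] conjI)
qed

end

section \<open>Comparison of the eigenvalues\<close>

lemma (in pendant_graph) rearrangement_exists:
  assumes "1 < p" and f: "\<forall>x\<in>boundary V E. f x = 0" "\<And>x. 0 \<le> f x"
  obtains h g k where "ranked_graph V E n p h g k" "\<And>x. x \<in> V \<Longrightarrow> f x = g (h x)"
proof -
  let ?I = "V - boundary V E"
  obtain r where r: "bij_betw r ?I {1..card ?I}"
    and mono: "\<And>x y. x \<in> ?I \<Longrightarrow> y \<in> ?I \<Longrightarrow> r x \<le> r y \<Longrightarrow> f y \<le> f x"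
    using finite_ranking[of ?I f] finite_V by blast
  define h where "h x = (if x \<in> boundary V E then n else r x)" for x
  define q where "q = the_inv_into ?I r"
  \<comment> \<open>The default 0 agrees with f on pendant vertices: their label n exceeds the
    number of interior vertices.\<close>
  define g where "g j = (if 1 \<le> j \<and> j \<le> card ?I then f (q j) else 0)" for j
  have q: "q j \<in> ?I" "r (q j) = j" if "1 \<le> j" "j \<le> card ?I" for j
    using that bij_betwE[OF bij_betw_the_inv_into[OF r]] f_the_inv_into_f_bij_betw[OF r, of j]
    by (auto simp: q_def)
  have "ranked_graph V E n p h g (card ?I)"
  proof (unfold_locales)
    show "bij_betw h ?I {1..card ?I}"
      using r bij_betw_cong[of ?I h r "{1..card ?I}"] by (simp add: h_def)
    show "g j \<le> g i" if "1 \<le> i" "i \<le> j" for i j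
      using that q[of i] q[of j] mono[of "q i" "q j"] f(2) by (auto simp: g_def)
  qed (use assms card_interior_less in \<open>auto simp: h_def g_def\<close>)
  moreover have "f x = g (h x)" if "x \<in> V" for x
  proof (cases "x \<in> boundary V E")
    case True
    then show ?thesis using f card_interior_less by (simp add: g_def h_def)
  next
    case False
    then have "r x \<in> {1..card ?I}" "q (r x) = x"
      using that bij_betwE[OF r] the_inv_into_f_f[OF bij_betw_imp_inj_on[OF r]] by (auto simp: q_def)
    then show ?thesis using False by (simp add: g_def h_def)
  qed
  ultimately show ?thesis using that by blast
qed

context ranked_graph
begin

lemma tadpole_admissible:
  assumes "\<exists>x\<in>V. g (h x) \<noteq> 0"
  shows "\<forall>x\<in>boundary (tadpole_V n) (tadpole_E n 3). g x = 0" "\<exists>x\<in>tadpole_V n. g x \<noteq> 0"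
  using assms boundary_tadpole_subset[OF n_ge] zero k_less h_range by (auto simp: tadpole_V_def)

lemma tadpole_rayleigh_le:
  "p_energy p (tadpole_V n) (tadpole_E n 3) g / p_norm_pow p (tadpole_V n) g
    \<le> p_energy p V E (g \<circ> h) / p_norm_pow p V (g \<circ> h)"
proof -
  have "p_norm_pow p (tadpole_V n) g = p_norm_pow p V (g \<circ> h)"
    unfolding norm_eq by (simp add: p_norm_pow_def tadpole_V_def)
  then show ?thesis
    using tadpole_energy_le p_energy_tadpole[OF n_ge]
    by (simp add: divide_right_mono p_norm_pow_nonneg)
qed

end

lemma (in pendant_graph) lambda1p_tadpole_le:
  assumes "1 < p"
  shows "lambda1p p (tadpole_V n) (tadpole_E n 3) \<le> lambda1p p V E"
proof (rule lambda1p_ge[OF interior_nonempty])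
  fix f assume f: "\<forall>x\<in>boundary V E. f x = (0::real)" "\<exists>x\<in>V. f x \<noteq> 0"
  \<comment> \<open>The rearrangement requires a nonnegative function, hence the passage to absolute
    values.\<close>
  obtain h g k where "ranked_graph V E n p h g k" and gh: "\<And>x. x \<in> V \<Longrightarrow> \<bar>f x\<bar> = g (h x)"
    using rearrangement_exists[of p "\<lambda>x. \<bar>f x\<bar>"] assms f by auto
  then interpret ranked_graph V E n p h g k by simp
  have "\<exists>x\<in>V. g (h x) \<noteq> 0" using f(2) gh by (metis abs_eq_0)
  from lambda1p_le[OF tadpole_admissible[OF this], of p]
  have "lambda1p p (tadpole_V n) (tadpole_E n 3) \<le> p_energy p V E (g \<circ> h) / p_norm_pow p V (g \<circ> h)"
    using tadpole_rayleigh_le by linarith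
  also have "\<dots> = p_energy p V E (\<lambda>x. \<bar>f x\<bar>) / p_norm_pow p V (\<lambda>x. \<bar>f x\<bar>)"
    using gh p_energy_cong[of V "g \<circ> h" "\<lambda>x. \<bar>f x\<bar>"] p_norm_pow_cong[of V "g \<circ> h" "\<lambda>x. \<bar>f x\<bar>"] by simp
  also have "\<dots> = p_energy p V E (\<lambda>x. \<bar>f x\<bar>) / p_norm_pow p V f"
    by (simp add: p_norm_pow_def)
  also have "\<dots> \<le> p_energy p V E f / p_norm_pow p V f"
    using assms by (intro divide_right_mono p_energy_abs_le p_norm_pow_nonneg) auto
  finally show "lambda1p p (tadpole_V n) (tadpole_E n 3) \<le> p_energy p V E f / p_norm_pow p V f" .
qed

lemma (in pendant_graph) iso_tadpole_if_lambda1p_eq: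
  assumes p: "1 < p" and eq: "lambda1p p V E = lambda1p p (tadpole_V n) (tadpole_E n 3)"
  shows "graph_iso V E (tadpole_V n) (tadpole_E n 3)"
proof -
  let ?L = "lambda1p p V E"
  obtain f where f: "\<forall>x\<in>boundary V E. f x = 0" "\<exists>x\<in>V. f x \<noteq> 0" "\<And>x. 0 \<le> f x"
    "p_energy p V E f = ?L * p_norm_pow p V f"
    using lambda1p_attained[OF finite_V interior_nonempty, of p] p by auto
  obtain h g k where "ranked_graph V E n p h g k" and gh: "\<And>x. x \<in> V \<Longrightarrow> f x = g (h x)"
    using rearrangement_exists[OF p f(1,3)] by blast
  then interpret ranked_graph V E n p h g k by simp
  have "p_energy p V E (g \<circ> h) = p_energy p V E f" "p_norm_pow p V (g \<circ> h) = p_norm_pow p V f"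
    using gh by (auto intro: p_energy_cong p_norm_pow_cong)
  then have En: "p_energy p V E (g \<circ> h) = ?L * (\<Sum>j=1..n. \<bar>g j\<bar> powr p)"
    using f(4) norm_eq by simp
  have min: "?L * (\<Sum>j=1..n. \<bar>u j\<bar> powr p) \<le> tadpole_energy p n u" if "u n = 0" for u
  proof -
    have "\<forall>x\<in>boundary (tadpole_V n) (tadpole_E n 3). u x = 0"
      using boundary_tadpole_subset[OF n_ge] that by auto
    from lambda1p_mult_le[OF _ this, of p] show ?thesis
      unfolding eq p_energy_tadpole[OF n_ge] by (simp add: p_norm_pow_def tadpole_V_def)
  qed
  have gn: "g n = 0" using zero k_less by simp
  \<comment> \<open>A squeeze: minimality on the tadpole bounds the energy from below and
    \<open>tadpole_energy_le\<close> from above. So g is a minimiser there and the rearrangement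
    loses nothing.\<close>
  have E2: "tadpole_energy p n g = ?L * (\<Sum>j=1..n. \<bar>g j\<bar> powr p)"
    using min[of g] gn tadpole_energy_le En by simp
  have "0 < g 1"
  proof -
    obtain x where x: "x \<in> V" "f x \<noteq> 0" using f(2) by blast
    then have "0 < g (h x)" using f(3)[of x] gh[of x] by simp
    also have "\<dots> \<le> g 1" using h_range[OF x(1)] by (intro anti) auto
    finally show ?thesis .
  qed
  then have "g (Suc j) < g j" if "2 \<le> j" "j < n" for j
    using tadpole_minimiser_strictly_decreasing[OF p n_ge min E2 anti gn] that by blast
  then show ?thesis using iso_tadpole_if_equality E2 En by simp
qed

theorem theorem1p3:
  fixes p :: real and V :: "'a set" and E :: "'a set set" and n :: nat
  assumes "p > 1"
    and "simple_graph V E" and "connected_graph V E"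
    and "card E = n" and "n \<ge> 4"
    and "boundary V E \<noteq> {}"
  shows "lambda1p p V E \<ge> lambda1p p (tadpole_V n) (tadpole_E n 3)
    \<and> (lambda1p p V E = lambda1p p (tadpole_V n) (tadpole_E n 3)
         \<longleftrightarrow> graph_iso V E (tadpole_V n) (tadpole_E n 3))"
proof -
  interpret pendant_graph V E n using assms by unfold_locales auto
  have "1 \<in> tadpole_V n - boundary (tadpole_V n) (tadpole_E n 3)"
    using boundary_tadpole_subset[OF \<open>n \<ge> 4\<close>] \<open>n \<ge> 4\<close> by (auto simp: tadpole_V_def)
  \<comment> \<open>An isomorphism gives this inequality; together with
    \<open>lambda1p_tadpole_le\<close> it yields equality.\<close>
  then have "lambda1p p V E \<le> lambda1p p (tadpole_V n) (tadpole_E n 3)"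
    if "graph_iso V E (tadpole_V n) (tadpole_E n 3)"
    using graph_iso_lambda1p_le[OF that] by blast
  then show ?thesis
    using lambda1p_tadpole_le[OF \<open>p > 1\<close>] iso_tadpole_if_lambda1p_eq[OF \<open>p > 1\<close>] by force
qed

end
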